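(* Let $\epsilon\in(0,1)$, $C_a,C_b,C_c\in\mathbb{R}^2$, $C_{abc}=(C_a^{\top},C_b^{\top},C_c^{\top})^{\top}\in\mathbb{R}^6$, and $r_a,r_b,r_c\ge 0$. Define $$B=(\epsilon^2A_p-A_n)-\lambda_{\min}(\epsilon^2A_p-A_n)\,\mathbb{I}_6,\qquad f=2(\epsilon^2A_p-A_n)C_{abc},$$ $$r_i=2\left(r_a\|B_i^{1,2}\|+r_b\|B_i^{3,4}\|+r_c\|B_i^{5,6}\|\right),\quad i=1,\dots,6,$$ and $\bar{D}_{abc}=\bar{D}(r_a)\times\bar{D}(r_b)\times\bar{D}(r_c)\subset\mathbb{R}^6$. Suppose that $$f_{i,i+1}\notin[-r_i,r_i]\times[-r_{i+1},r_{i+1}],\quad i=1,3,5,$$ $$\min_{Y\in\bar{D}_{abc}}\|(2BY+f)_{1,2}\|^2\ge 4(2+\epsilon^2)^2r_a^2,$$ $$\min_{Y\in\bar{D}_{abc}}\|(2BY+f)_{3,4}\|^2\ge 4(2+\epsilon^2)^2r_b^2,$$ $$\min_{Y\in\bar{D}_{abc}}\|(2BY+f)_{5,6}\|^2\ge 4(2+\epsilon^2)^2r_c^2.$$ Then strong duality holds between the nonconvex problem $$\max_{V_{abc}\in\partial\mathcal{V}^a_{in}\times\partial\mathcal{V}^b_{in}\times\partial\mathcal{V}^c_{in}}V_{abc}^{\top}(A_n-\epsilon^2A_p)V_{abc}$$ and its Lagrangian relaxation (LGR) given in the context; that is, the two problems have the same optimal value.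
   Context: $\|\cdot\|$ is the Euclidean norm; $\partial S$ is the boundary of $S\subset\mathbb{R}^2$; $\mathbb{I}_n$ is the $n\times n$ identity; $\lambda_{\min}$ is the smallest eigenvalue; $\bar{D}(r)=\{x\in\mathbb{R}^2:\|x\|\le r\}$. For $p\in\{a,b,c\}$, $\mathcal{V}^p_{in}=\{x\in\mathbb{R}^2:\|x-C_p\|\le r_p\}$. Products of three subsets of $\mathbb{R}^2$ are regarded as subsets of $\mathbb{R}^6$. For a vector $x$, $x_{i,j}$ ($i\le j$) is the subvector of entries $i$ through $j$; for a matrix $X$, $X_i^{j,k}$ is the vector formed by the $j$-th through $k$-th entries of row $i$ of $X$. With angles in degrees, $$A_n=\begin{bmatrix}\mathbb{I}_2 & B_n & B_n^{\top} \\ B_n^{\top} & \mathbb{I}_2 & B_n \\ B_n & B_n^{\top} & \mathbb{I}_2\end{bmatrix},\ B_n=\begin{bmatrix}\cos 240&-\sin 240\\ \sin 240&\cos 240\end{bmatrix},$$ $$A_p=\begin{bmatrix}\mathbb{I}_2 & B_p & B_p^{\top} \\ B_p^{\top} & \mathbb{I}_2 & B_p \\ B_p & B_p^{\top} & \mathbb{I}_2\end{bmatrix},\ B_p=\begin{bmatrix}\cos 120&-\sin 120\\ \sin 120&\cos 120\end{bmatrix}.$$ The Lagrangian relaxation (LGR) is the semidefinite program that minimizes $\gamma$ over $\mu=(\mu_1,\mu_2,\mu_3)\in\mathbb{R}^3$ and $\gamma\in\mathbb{R}$ (optimal value understood as an infimum) subject to $$\begin{bmatrix}Q(\mu) & q(\mu)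 \\ q(\mu)^{\top} & r(\mu)\end{bmatrix}\succeq0,$$ where $$Q(\mu)=-\left(A_n-\epsilon^2A_p+\mathrm{blkdiag}(\mu_1\mathbb{I}_2,\mu_2\mathbb{I}_2,\mu_3\mathbb{I}_2)\right),\quad q(\mu)=(-\mu_1C_a^{\top},-\mu_2C_b^{\top},-\mu_3C_c^{\top})^{\top},$$ $$r(\mu)=\gamma-\mu_1(\|C_a\|^2-r_a^2)-\mu_2(\|C_b\|^2-r_b^2)-\mu_3(\|C_c\|^2-r_c^2).$$ *)

theory Defs
  imports "HOL-Analysis.Analysis"
begin

text \<open>Indices of \<^typ>\<open>6\<close> and \<^typ>\<open>7\<close> are written 1, ..., 6 and 1, ..., 7; as elements of these
  types, 6 and 7 are the same as 0.\<close>

definition stack3 :: "real^2 \<Rightarrow> real^2 \<Rightarrow> real^2 \<Rightarrow> real^6" where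
  "stack3 a b c = vector [a$1, a$2, b$1, b$2, c$1, c$2]"

definition product3 :: "(real^2) set \<Rightarrow> (real^2) set \<Rightarrow> (real^2) set \<Rightarrow> (real^6) set" where
  "product3 S T U = {stack3 a b c | a b c. a \<in> S \<and> b \<in> T \<and> c \<in> U}"

definition subvec2 :: "real^6 \<Rightarrow> 6 \<Rightarrow> real^2" where
  "subvec2 x i = vector [x$i, x$(i + 1)]"

text \<open>\<^term>\<open>A $ i\<close> is row \<^term>\<open>i\<close> of \<^term>\<open>A\<close>, so both block matrices below are lists of rows.\<close>

definition block3 ::
  "real^2^2 \<Rightarrow> real^2^2 \<Rightarrow> real^2^2 \<Rightarrow>
   real^2^2 \<Rightarrow> real^2^2 \<Rightarrow> real^2^2 \<Rightarrow>
   real^2^2 \<Rightarrow> real^2^2 \<Rightarrow> real^2^2 \<Rightarrow> real^6^6" where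
  "block3 A11 A12 A13 A21 A22 A23 A31 A32 A33 = vector
     [stack3 (A11$1) (A12$1) (A13$1), stack3 (A11$2) (A12$2) (A13$2),
      stack3 (A21$1) (A22$1) (A23$1), stack3 (A21$2) (A22$2) (A23$2),
      stack3 (A31$1) (A32$1) (A33$1), stack3 (A31$2) (A32$2) (A33$2)]"

definition snoc6 :: "real^6 \<Rightarrow> real \<Rightarrow> real^7" where
  "snoc6 x t = vector [x$1, x$2, x$3, x$4, x$5, x$6, t]"

definition bordered :: "real^6^6 \<Rightarrow> real^6 \<Rightarrow> real \<Rightarrow> real^7^7" where
  "bordered Q q r = vector
     [snoc6 (Q$1) (q$1), snoc6 (Q$2) (q$2), snoc6 (Q$3) (q$3),
      snoc6 (Q$4) (q$4), snoc6 (Q$5) (q$5), snoc6 (Q$6) (q$6), snoc6 q r]"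

definition eigenvalues :: "real^'n^'n \<Rightarrow> real set" where
  "eigenvalues A = {l. \<exists>v. v \<noteq> 0 \<and> A *v v = l *\<^sub>R v}"

text \<open>Only applied to real symmetric matrices, whose set of real eigenvalues is finite and nonempty.\<close>

definition lambda_min :: "real^'n^'n \<Rightarrow> real" where
  "lambda_min A = Min (eigenvalues A)"

definition psd :: "real^'n^'n \<Rightarrow> bool" where
  "psd A \<longleftrightarrow> transpose A = A \<and> (\<forall>x. 0 \<le> x \<bullet> (A *v x))"

definition rotation_deg :: "real \<Rightarrow> real^2^2" where
  "rotation_deg d = (let t = d * pi / 180 in
     vector [vector [cos t, - sin t], vector [sin t, cos t]])"

definition sequence_matrix :: "real^2^2 \<Rightarrow> real^6^6" where
  "sequence_matrix R = block3
     (mat 1)       R             (transpose R)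
     (transpose R) (mat 1)       R
     R             (transpose R) (mat 1)"

definition A_n :: "real^6^6" where
  "A_n = sequence_matrix (rotation_deg 240)"

definition A_p :: "real^6^6" where
  "A_p = sequence_matrix (rotation_deg 120)"

text \<open>\<^term>\<open>frontier (cball C 0) = {C}\<close> in the plane, so radius 0 needs no separate treatment.
  Optimal values are extended reals, so that neither an empty feasible set nor an unbounded
  objective can produce an unspecified value. The primal feasible set is compact and nonempty for
  nonnegative radii, so the supremum there is a maximum.\<close>

definition primal_feasible ::
  "real^2 \<Rightarrow> real^2 \<Rightarrow> real^2 \<Rightarrow> real \<Rightarrow> real \<Rightarrow> real \<Rightarrow> (real^6) set" where
  "primal_feasible Ca Cb Cc ra rb rc =
     product3 (frontier (cball Ca ra)) (frontier (cball Cb rb)) (frontier (cball Cc rc))"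

definition primal_value ::
  "real \<Rightarrow> real^2 \<Rightarrow> real^2 \<Rightarrow> real^2 \<Rightarrow> real \<Rightarrow> real \<Rightarrow> real \<Rightarrow> ereal" where
  "primal_value \<epsilon> Ca Cb Cc ra rb rc =
     (SUP V \<in> primal_feasible Ca Cb Cc ra rb rc. ereal (V \<bullet> ((A_n - \<epsilon>\<^sup>2 *\<^sub>R A_p) *v V)))"

definition LGR_Q :: "real \<Rightarrow> real^3 \<Rightarrow> real^6^6" where
  "LGR_Q \<epsilon> \<mu> = - (A_n - \<epsilon>\<^sup>2 *\<^sub>R A_p +
     block3 (\<mu>$1 *\<^sub>R mat 1) 0 0
            0 (\<mu>$2 *\<^sub>R mat 1) 0
            0 0 (\<mu>$3 *\<^sub>R mat 1))"

definition LGR_q :: "real^2 \<Rightarrow> real^2 \<Rightarrow> real^2 \<Rightarrow> real^3 \<Rightarrow> real^6" where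
  "LGR_q Ca Cb Cc \<mu> = stack3 (- \<mu>$1 *\<^sub>R Ca) (- \<mu>$2 *\<^sub>R Cb) (- \<mu>$3 *\<^sub>R Cc)"

definition LGR_r ::
  "real^2 \<Rightarrow> real^2 \<Rightarrow> real^2 \<Rightarrow> real \<Rightarrow> real \<Rightarrow> real \<Rightarrow> real^3 \<Rightarrow> real \<Rightarrow> real" where
  "LGR_r Ca Cb Cc ra rb rc \<mu> \<gamma> =
     \<gamma> - \<mu>$1 * ((norm Ca)\<^sup>2 - ra\<^sup>2) - \<mu>$2 * ((norm Cb)\<^sup>2 - rb\<^sup>2) - \<mu>$3 * ((norm Cc)\<^sup>2 - rc\<^sup>2)"

definition LGR_feasible ::
  "real \<Rightarrow> real^2 \<Rightarrow> real^2 \<Rightarrow> real^2 \<Rightarrow> real \<Rightarrow> real \<Rightarrow> real \<Rightarrow> ((real^3) \<times> real) set" where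
  "LGR_feasible \<epsilon> Ca Cb Cc ra rb rc =
     {(\<mu>, \<gamma>). psd (bordered (LGR_Q \<epsilon> \<mu>) (LGR_q Ca Cb Cc \<mu>) (LGR_r Ca Cb Cc ra rb rc \<mu> \<gamma>))}"

definition LGR_value ::
  "real \<Rightarrow> real^2 \<Rightarrow> real^2 \<Rightarrow> real^2 \<Rightarrow> real \<Rightarrow> real \<Rightarrow> real \<Rightarrow> ereal" where
  "LGR_value \<epsilon> Ca Cb Cc ra rb rc =
     (INF (\<mu>, \<gamma>) \<in> LGR_feasible \<epsilon> Ca Cb Cc ra rb rc. ereal \<gamma>)"

end

(* Put V = C + W. On the product of circles |W|^2 is constant, so maximising the objective
   V^T (A_n - eps^2 A_p) V amounts to minimising the convex function g(W) = W^T B W + f^T W.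
   Minimise g over the product of discs instead. The box condition keeps each planar block of the
   gradient 2BW + f away from 0 on the discs, so each block of the minimiser lies on its circle,
   antiparallel to the gradient block: the relaxation to discs is exact, and the ratio of the two
   norms gives nonnegative multipliers nu_j. Then mu_j = lambda_min - nu_j is feasible for the LGR
   with the primal value. A radius that vanishes admits no exact multiplier; there nu_j is taken
   large, and the value is attained only in the limit. *)

theory Submission
  imports Defs
begin

section \<open>Coordinates in dimensions six and seven\<close>

lemma exhaust_6:
  fixes x :: 6
  shows "x = 1 \<or> x = 2 \<or> x = 3 \<or> x = 4 \<or> x = 5 \<or> x = 6"
proof (induct x)
  case (of_int z)
  \<comment> \<open>Integer representatives run over 0, ..., 5; the representative 0 is the index
    written \<open>6\<close> in the goal.\<close>
  then have "z = 0 \<or> z = 1 \<or> z = 2 \<or> z = 3 \<or> z = 4 \<or> z = 5" by fastforce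
  then show ?case by auto
qed

lemma exhaust_7:
  fixes x :: 7
  shows "x = 1 \<or> x = 2 \<or> x = 3 \<or> x = 4 \<or> x = 5 \<or> x = 6 \<or> x = 7"
proof (induct x)
  case (of_int z)
  then have "z = 0 \<or> z = 1 \<or> z = 2 \<or> z = 3 \<or> z = 4 \<or> z = 5 \<or> z = 6" by fastforce
  then show ?case by auto
qed

lemma forall_6: "(\<forall>i::6. P i) \<longleftrightarrow> P 1 \<and> P 2 \<and> P 3 \<and> P 4 \<and> P 5 \<and> P 6"
  by (metis exhaust_6)

lemma forall_7: "(\<forall>i::7. P i) \<longleftrightarrow> P 1 \<and> P 2 \<and> P 3 \<and> P 4 \<and> P 5 \<and> P 6 \<and> P 7"
  by (metis exhaust_7)

lemma UNIV_6: "UNIV = {1, 2, 3, 4, 5, 6::6}"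
  using exhaust_6 by auto

lemma UNIV_7: "UNIV = {1, 2, 3, 4, 5, 6, 7::7}"
  using exhaust_7 by auto

lemma sum_6: "sum f (UNIV::6 set) = f 1 + f 2 + f 3 + f 4 + f 5 + f 6"
  unfolding UNIV_6 by (simp add: ac_simps)

lemma sum_7: "sum f (UNIV::7 set) = f 1 + f 2 + f 3 + f 4 + f 5 + f 6 + f 7"
  unfolding UNIV_7 by (simp add: ac_simps)

lemma vector_6:
  "(vector [a,b,c,d,e,f] :: ('a::zero)^6)$1 = a"
  "(vector [a,b,c,d,e,f] :: ('a::zero)^6)$2 = b"
  "(vector [a,b,c,d,e,f] :: ('a::zero)^6)$3 = c"
  "(vector [a,b,c,d,e,f] :: ('a::zero)^6)$4 = d"
  "(vector [a,b,c,d,e,f] :: ('a::zero)^6)$5 = e"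
  "(vector [a,b,c,d,e,f] :: ('a::zero)^6)$6 = f"
  unfolding vector_def by simp_all

lemma vector_7:
  "(vector [a,b,c,d,e,f,g] :: ('a::zero)^7)$1 = a"
  "(vector [a,b,c,d,e,f,g] :: ('a::zero)^7)$2 = b"
  "(vector [a,b,c,d,e,f,g] :: ('a::zero)^7)$3 = c"
  "(vector [a,b,c,d,e,f,g] :: ('a::zero)^7)$4 = d"
  "(vector [a,b,c,d,e,f,g] :: ('a::zero)^7)$5 = e"
  "(vector [a,b,c,d,e,f,g] :: ('a::zero)^7)$6 = f"
  "(vector [a,b,c,d,e,f,g] :: ('a::zero)^7)$7 = g"
  unfolding vector_def by simp_all

lemma stack3_nth:
  "stack3 a b c $ 1 = a $ 1" "stack3 a b c $ 2 = a $ 2"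
  "stack3 a b c $ 3 = b $ 1" "stack3 a b c $ 4 = b $ 2"
  "stack3 a b c $ 5 = c $ 1" "stack3 a b c $ 6 = c $ 2"
  by (simp_all only: stack3_def vector_6)

lemma snoc6_nth:
  "snoc6 x t $ 1 = x $ 1" "snoc6 x t $ 2 = x $ 2" "snoc6 x t $ 3 = x $ 3" "snoc6 x t $ 4 = x $ 4"
  "snoc6 x t $ 5 = x $ 5" "snoc6 x t $ 6 = x $ 6" "snoc6 x t $ 7 = t"
  by (simp_all only: snoc6_def vector_7)

text \<open>Evaluates \<open>i + 1\<close> at the three block offsets where \<open>subvec2\<close>
  is read.\<close>

lemma index_succ_6: "(1::6) + 1 = 2" "(3::6) + 1 = 4" "(5::6) + 1 = 6"
  by simp_all

lemma subvec2_nth: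
  "subvec2 x 1 $ 1 = x $ 1" "subvec2 x 1 $ 2 = x $ 2"
  "subvec2 x 3 $ 1 = x $ 3" "subvec2 x 3 $ 2 = x $ 4"
  "subvec2 x 5 $ 1 = x $ 5" "subvec2 x 5 $ 2 = x $ 6"
  by (simp_all only: subvec2_def vector_2 index_succ_6)

lemma subvec2_stack3:
  "subvec2 (stack3 a b c) 1 = a" "subvec2 (stack3 a b c) 3 = b" "subvec2 (stack3 a b c) 5 = c"
  by (simp_all only: vec_eq_iff forall_2 subvec2_nth stack3_nth simp_thms)

lemma stack3_subvec2: "stack3 (subvec2 x 1) (subvec2 x 3) (subvec2 x 5) = x"
  by (simp only: vec_eq_iff forall_6 subvec2_nth stack3_nth simp_thms)

lemma ex_stack3: "\<exists>a b c. x = stack3 a b c"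
  using stack3_subvec2 by metis

lemma stack3_add: "stack3 a b c + stack3 a' b' c' = stack3 (a + a') (b + b') (c + c')"
  by (simp only: vec_eq_iff forall_6 stack3_nth vector_add_component simp_thms)

lemma stack3_diff: "stack3 a b c - stack3 a' b' c' = stack3 (a - a') (b - b') (c - c')"
  by (simp only: vec_eq_iff forall_6 stack3_nth vector_minus_component simp_thms)

lemma stack3_scaleR: "t *\<^sub>R stack3 a b c = stack3 (t *\<^sub>R a) (t *\<^sub>R b) (t *\<^sub>R c)"
  by (simp only: vec_eq_iff forall_6 stack3_nth vector_scaleR_component simp_thms)

lemma inner_stack3: "stack3 a b c \<bullet> stack3 a' b' c' = a \<bullet> a' + b \<bullet> b' + c \<bullet> c'"
  by (simp only: inner_vec_def sum_6 sum_2 stack3_nth add.assoc)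

lemma norm_stack3: "(norm (stack3 a b c))\<^sup>2 = (norm a)\<^sup>2 + (norm b)\<^sup>2 + (norm c)\<^sup>2"
  by (simp add: power2_norm_eq_inner inner_stack3)

lemma inner_subvec2:
  "x \<bullet> y = subvec2 x 1 \<bullet> subvec2 y 1 + subvec2 x 3 \<bullet> subvec2 y 3 + subvec2 x 5 \<bullet> subvec2 y 5"
  by (metis inner_stack3 stack3_subvec2)

lemma inner_snoc6: "snoc6 x s \<bullet> snoc6 y t = x \<bullet> y + s * t"
  by (simp add: inner_vec_def sum_6 sum_7 snoc6_nth)

lemma ex_snoc6: "\<exists>x t. z = snoc6 x t"
proof -
  have "z = snoc6 (vector [z$1, z$2, z$3, z$4, z$5, z$6]) (z$7)"
    by (simp only: vec_eq_iff forall_7 snoc6_nth vector_6 simp_thms)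
  then show ?thesis by blast
qed

lemma block3_mult_stack3:
  "block3 A11 A12 A13 A21 A22 A23 A31 A32 A33 *v stack3 a b c =
     stack3 (A11 *v a + A12 *v b + A13 *v c) (A21 *v a + A22 *v b + A23 *v c)
       (A31 *v a + A32 *v b + A33 *v c)"
  by (simp only: vec_eq_iff forall_6 matrix_vector_mul_component vector_add_component stack3_nth
      block3_def vector_6 inner_stack3 simp_thms)

lemma bordered_mult_snoc6:
  "bordered Q q r *v snoc6 x t = snoc6 (Q *v x + t *\<^sub>R q) (q \<bullet> x + r * t)"
  by (simp add: vec_eq_iff forall_7 matrix_vector_mul_component snoc6_nth
      bordered_def vector_7 inner_snoc6)

lemma transpose_block3:
  "transpose (block3 A11 A12 A13 A21 A22 A23 A31 A32 A33) =
     block3 (transpose A11) (transpose A21) (transpose A31)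
       (transpose A12) (transpose A22) (transpose A32)
       (transpose A13) (transpose A23) (transpose A33)"
  by (simp add: vec_eq_iff forall_6 transpose_def block3_def vector_6 stack3_nth)

lemma transpose_bordered:
  assumes "transpose Q = Q"
  shows "transpose (bordered Q q r) = bordered Q q r"
proof -
  have sym: "Q $ i $ j = Q $ j $ i" for i j
    using arg_cong[OF assms, of "\<lambda>A. A $ j $ i"] by (simp add: transpose_def)
  show ?thesis
    by (simp only: vec_eq_iff forall_7 transpose_def vec_lambda_beta bordered_def vector_7
        snoc6_nth) (intro conjI refl sym)
qed

lemma transpose_add: "transpose (A + B) = transpose A + transpose B"
  by (simp add: transpose_def vec_eq_iff)

lemma transpose_diff: "transpose (A - B) = transpose A - transpose (B :: 'a::group_add^'n^'m)"
  by (simp add: transpose_def vec_eq_iff)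

lemma transpose_uminus: "transpose (- A) = - transpose (A :: 'a::group_add^'n^'m)"
  by (simp add: transpose_def vec_eq_iff)

text \<open>In \<open>sequence_matrix\<close> mirrored off-diagonal blocks are transposes of each
  other, so both matrices are symmetric.\<close>

lemma transpose_objective: "transpose (A_n - t *\<^sub>R A_p) = A_n - t *\<^sub>R A_p"
  by (simp add: A_n_def A_p_def sequence_matrix_def transpose_block3 transpose_diff
      transpose_scalar)

section \<open>The smallest eigenvalue\<close>

text \<open>Dividing by \<open>t\<close> and letting \<open>t\<close> tend to 0 leaves the linear
  coefficient. This serves as the first-order optimality condition, both on the sphere and on the
  discs.\<close>

lemma linear_coefficient_nonneg:
  fixes b c :: real
  assumes "\<And>t. 0 < t \<Longrightarrow> t \<le> 1 \<Longrightarrow> 0 \<le> t * b + t\<^sup>2 * c"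
  shows "0 \<le> b"
proof (rule ccontr)
  assume "\<not> 0 \<le> b"
  \<comment> \<open>Chosen so that \<open>t * \<bar>c\<bar>\<close> stays below half of
    \<open>- b\<close>; the \<open>+ 1\<close> keeps the denominator positive when
    \<open>c = 0\<close>.\<close>
  define t where "t = min 1 (- b / (2 * (\<bar>c\<bar> + 1)))"
  have t: "0 < t" "t \<le> 1" "t \<le> - b / (2 * (\<bar>c\<bar> + 1))"
    using \<open>\<not> 0 \<le> b\<close> by (auto simp: t_def divide_neg_pos)
  then have t': "t * (2 * (\<bar>c\<bar> + 1)) \<le> - b"
    by (subst (asm) pos_le_divide_eq) auto
  have "0 \<le> t * (b + t * c)"
    using assms[OF t(1,2)] by (simp add: algebra_simps power2_eq_square)
  then have "0 \<le> b + t * c"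
    using t(1) by (simp add: zero_le_mult_iff)
  moreover have "t * c \<le> t * \<bar>c\<bar>"
    using t(1) by (intro mult_left_mono) auto
  moreover have "2 * t + 2 * (t * \<bar>c\<bar>) \<le> - b"
    using t' by (simp add: algebra_simps)
  ultimately show False
    using t(1) \<open>\<not> 0 \<le> b\<close> by linarith
qed

lemma symmetric_inner_swap:
  fixes A :: "real^'n^'n"
  assumes "transpose A = A"
  shows "x \<bullet> (A *v y) = (A *v x) \<bullet> y"
  using assms by (metis dot_lmul_matrix transpose_matrix_vector)

lemma quadratic_form_add:
  fixes A :: "real^'n^'n"
  assumes "transpose A = A"
  shows "(x + y) \<bullet> (A *v (x + y)) = x \<bullet> (A *v x) + 2 * ((A *v x) \<bullet> y) + y \<bullet> (A *v y)"
  using symmetric_inner_swap[OF assms, of x y]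
  by (simp add: matrix_vector_right_distrib inner_add_left inner_add_right inner_commute)

text \<open>Eigenvectors of a symmetric matrix for distinct eigenvalues are orthogonal, so one
  chosen per eigenvalue gives an independent, hence finite, family. Finiteness is what makes the
  \<open>Min\<close> in \<open>lambda_min\<close> meaningful.\<close>

lemma finite_eigenvalues:
  fixes A :: "real^'n^'n"
  assumes "transpose A = A"
  shows "finite (eigenvalues A)"
proof -
  define v where "v l = (SOME v. v \<noteq> 0 \<and> A *v v = l *\<^sub>R v)" for l
  have v: "v l \<noteq> 0 \<and> A *v v l = l *\<^sub>R v l" if "l \<in> eigenvalues A" for l
    unfolding v_def by (rule someI_ex) (use that in \<open>simp add: eigenvalues_def\<close>)
  have orth: "v l \<bullet> v m = 0" if "l \<in> eigenvalues A" "m \<in> eigenvalues A" "l \<noteq> m" for l m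
    using symmetric_inner_swap[OF assms, of "v l" "v m"] v[OF that(1)] v[OF that(2)] that(3)
    by simp
  have "inj_on v (eigenvalues A)"
    using orth v by (metis inj_onI inner_eq_zero_iff)
  moreover have "finite (v ` eigenvalues A)"
  proof (rule independent_imp_finite, rule pairwise_orthogonal_independent)
    show "pairwise orthogonal (v ` eigenvalues A)"
      using orth by (auto simp: pairwise_def orthogonal_def)
    show "0 \<notin> v ` eigenvalues A"
      using v by force
  qed
  ultimately show ?thesis
    using finite_imageD by blast
qed

text \<open>Rayleigh's principle: a minimiser of the form on the unit sphere is an eigenvector, and
  the minimum is its eigenvalue, hence at least \<open>lambda_min A\<close>.\<close>

lemma lambda_min_le_quadratic_form:
  fixes A :: "real^'n^'n"
  assumes sym: "transpose A = A"
  shows "lambda_min A * (norm x)\<^sup>2 \<le> x \<bullet> (A *v x)"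
proof -
  have "continuous_on (sphere 0 1) (\<lambda>x. x \<bullet> (A *v x))"
    by (intro continuous_intros linear_continuous_on matrix_vector_mul_bounded_linear)
  moreover have "sphere (0 :: real^'n) 1 \<noteq> {}"
    by simp
  ultimately obtain v where v: "v \<in> sphere 0 1"
    and least: "\<And>y. y \<in> sphere 0 1 \<Longrightarrow> v \<bullet> (A *v v) \<le> y \<bullet> (A *v y)"
    using continuous_attains_inf[OF compact_sphere] by blast
  define l where "l = v \<bullet> (A *v v)"
  \<comment> \<open>Homogeneity carries the bound from the unit sphere to all vectors.\<close>
  have bound: "l * (norm y)\<^sup>2 \<le> y \<bullet> (A *v y)" for y
  proof (cases "y = 0")
    case False
    then have "l \<le> ((1 / norm y) *\<^sub>R y) \<bullet> (A *v ((1 / norm y) *\<^sub>R y))"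
      unfolding l_def by (intro least) simp
    with False show ?thesis
      by (simp add: matrix_vector_mult_scaleR field_simps power2_eq_square)
  qed simp
  have "A *v v = l *\<^sub>R v"
  proof -
    \<comment> \<open>The function \<open>y \<bullet> (A *v y) - l * (norm y)\<^sup>2\<close> is
      nonnegative and vanishes at \<open>v\<close>. Its derivative there in direction
      \<open>- w\<close> is \<open>- 2 * (norm w)\<^sup>2\<close>, which must be nonnegative, so the
      residual \<open>w\<close> is 0.\<close>
    define w where "w = A *v v - l *\<^sub>R v"
    have "0 \<le> - (2 * (norm w)\<^sup>2)"
    proof (rule linear_coefficient_nonneg)
      fix t :: real
      have form: "(v + (- t) *\<^sub>R w) \<bullet> (A *v (v + (- t) *\<^sub>R w)) =
          l - 2 * t * ((A *v v) \<bullet> w) + t\<^sup>2 * (w \<bullet> (A *v w))"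
        unfolding quadratic_form_add[OF sym] matrix_vector_mult_scaleR
        by (simp add: l_def power2_eq_square)
      have norm_sq: "(norm (v + (- t) *\<^sub>R w))\<^sup>2 = 1 - 2 * t * (v \<bullet> w) + t\<^sup>2 * (norm w)\<^sup>2"
        using v unfolding power2_norm_eq_inner
        by (simp add: inner_add_left inner_add_right inner_commute power2_eq_square
            norm_eq_1 algebra_simps)
      have w: "(norm w)\<^sup>2 = (A *v v) \<bullet> w - l * (v \<bullet> w)"
        by (simp add: power2_norm_eq_inner w_def inner_diff_left)
      show "0 \<le> t * - (2 * (norm w)\<^sup>2) + t\<^sup>2 * (w \<bullet> (A *v w) - l * (norm w)\<^sup>2)"
        using bound[of "v + (- t) *\<^sub>R w"] unfolding form norm_sq w
        by (simp add: algebra_simps)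
    qed
    then show ?thesis by (simp add: w_def)
  qed
  moreover have "v \<noteq> 0" using v by auto
  ultimately have "l \<in> eigenvalues A"
    by (auto simp: eigenvalues_def)
  then have "lambda_min A \<le> l"
    unfolding lambda_min_def by (intro Min_le finite_eigenvalues sym)
  then have "lambda_min A * (norm x)\<^sup>2 \<le> l * (norm x)\<^sup>2"
    by (intro mult_right_mono) auto
  with bound show ?thesis by (rule order_trans[rotated])
qed

section \<open>Multipliers on a disc\<close>

text \<open>Comparing \<open>x\<close> with the boundary point antiparallel to \<open>d\<close> puts
  \<open>x\<close> in the equality case of Cauchy-Schwarz, which determines it.\<close>

lemma linear_min_on_cball:
  fixes x d :: "'a::real_inner"
  assumes x: "x \<in> cball 0 \<rho>"
    and min: "\<And>y. y \<in> cball 0 \<rho> \<Longrightarrow> 0 \<le> d \<bullet> (y - x)"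
    and d: "d \<noteq> 0"
  shows "x = - (\<rho> / norm d) *\<^sub>R d"
proof -
  have \<rho>: "norm x \<le> \<rho>" "0 \<le> \<rho>"
    using x norm_ge_zero[of x] by (auto simp del: norm_ge_zero)
  have "0 \<le> d \<bullet> (- (\<rho> / norm d) *\<^sub>R d - x)"
    using \<rho> d by (intro min) simp
  then have le: "d \<bullet> x \<le> - (\<rho> * norm d)"
    using d by (simp add: inner_diff_right power2_norm_eq_inner[symmetric] power2_eq_square)
  \<comment> \<open>The squared distance from \<open>x\<close> to the antiparallel point turns out
    to be at most 0.\<close>
  have "(norm (x + (\<rho> / norm d) *\<^sub>R d))\<^sup>2 = (norm x)\<^sup>2 + 2 * (\<rho> / norm d) * (d \<bullet> x) + \<rho>\<^sup>2"
  proof -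
    have "(\<rho> / norm d) * (\<rho> / norm d) * (d \<bullet> d) = \<rho>\<^sup>2"
      using d by (simp add: power2_norm_eq_inner[symmetric] power2_eq_square)
    then show ?thesis
      unfolding power2_norm_eq_inner
      by (simp add: inner_add_left inner_add_right inner_commute)
  qed
  also have "\<dots> \<le> \<rho>\<^sup>2 + 2 * (\<rho> / norm d) * - (\<rho> * norm d) + \<rho>\<^sup>2"
    using \<rho> by (intro add_mono mult_left_mono le power_mono) auto
  also have "\<dots> = 0"
    using d by (simp add: power2_eq_square)
  finally have "x + (\<rho> / norm d) *\<^sub>R d = 0"
    by simp
  then show ?thesis by (simp add: eq_neg_iff_add_eq_0)
qed

text \<open>A Lagrange multiplier for minimising \<open>d\<close> over the disc, valid for every
  displacement \<open>h\<close> and not only for those inside the disc. The slack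
  \<open>\<delta>\<close> covers radius 0, where the constraint gradient
  \<open>2 *\<^sub>R x\<close> vanishes and cannot balance \<open>d\<close>.\<close>

lemma disc_multiplier:
  fixes d :: "'a::real_inner"
  assumes x: "x = - (\<rho> / norm d) *\<^sub>R d" and d: "d \<noteq> 0" and \<rho>: "0 \<le> \<rho>" and \<delta>: "0 < \<delta>"
  shows "\<exists>\<nu>\<ge>0. \<forall>h. - \<delta> \<le> d \<bullet> h + \<nu> * ((norm (x + h))\<^sup>2 - \<rho>\<^sup>2)"
proof (cases "\<rho> = 0")
  case True
  \<comment> \<open>Young's inequality: this coefficient makes the quadratic term dominate
    \<open>norm d * norm h\<close> up to \<open>\<delta>\<close>, by completing a square.\<close>
  have "- \<delta> \<le> d \<bullet> h + (norm d)\<^sup>2 / (4 * \<delta>) * ((norm (x + h))\<^sup>2 - \<rho>\<^sup>2)" for h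
  proof -
    have "0 \<le> (norm d * norm h - 2 * \<delta>)\<^sup>2 / (4 * \<delta>)"
      using \<delta> by simp
    also have "\<dots> = (norm d)\<^sup>2 / (4 * \<delta>) * (norm h)\<^sup>2 - norm d * norm h + \<delta>"
      using \<delta> by (simp add: power2_eq_square field_simps)
    finally show ?thesis
      using norm_cauchy_schwarz[of "- d" h] True x by simp
  qed
  moreover have "0 \<le> (norm d)\<^sup>2 / (4 * \<delta>)"
    using \<delta> by simp
  ultimately show ?thesis by blast
next
  case False
  \<comment> \<open>For positive radius the exact multiplier solves
    \<open>2 * \<nu> *\<^sub>R x = - d\<close>; the linear terms cancel and a nonnegative square
    remains.\<close>
  have "- \<delta> \<le> d \<bullet> h + norm d / (2 * \<rho>) * ((norm (x + h))\<^sup>2 - \<rho>\<^sup>2)" for h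
  proof -
    have "norm x = \<rho>"
      using x d \<rho> by simp
    then have "(norm (x + h))\<^sup>2 - \<rho>\<^sup>2 = 2 * (x \<bullet> h) + (norm h)\<^sup>2"
      by (auto simp: power2_norm_eq_inner inner_add_left inner_add_right inner_commute)
    moreover have "norm d / (2 * \<rho>) * (2 * (x \<bullet> h)) = - (d \<bullet> h)"
      using x d False by simp
    moreover have "0 \<le> norm d / (2 * \<rho>) * (norm h)\<^sup>2"
      using \<rho> by simp
    ultimately show ?thesis
      using \<delta> by (simp add: distrib_left)
  qed
  moreover have "0 \<le> norm d / (2 * \<rho>)"
    using \<rho> by simp
  ultimately show ?thesis by blast
qed

section \<open>The Lagrangian relaxation\<close>

lemma transpose_LGR_Q: "transpose (LGR_Q \<epsilon> \<mu>) = LGR_Q \<epsilon> \<mu>"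
proof -
  have "transpose (0 :: real^2^2) = 0"
    by (simp add: transpose_def vec_eq_iff)
  then show ?thesis
    by (simp only: LGR_Q_def transpose_uminus transpose_add transpose_objective transpose_block3
        transpose_scalar transpose_mat)
qed

lemma LGR_Q_quadratic_form:
  "stack3 a b c \<bullet> (LGR_Q \<epsilon> \<mu> *v stack3 a b c) =
     stack3 a b c \<bullet> ((\<epsilon>\<^sup>2 *\<^sub>R A_p - A_n) *v stack3 a b c)
       - \<mu>$1 * (norm a)\<^sup>2 - \<mu>$2 * (norm b)\<^sup>2 - \<mu>$3 * (norm c)\<^sup>2"
proof -
  have LGR_Q: "LGR_Q \<epsilon> \<mu> = (\<epsilon>\<^sup>2 *\<^sub>R A_p - A_n) -
     block3 (\<mu>$1 *\<^sub>R mat 1) 0 0 0 (\<mu>$2 *\<^sub>R mat 1) 0 0 0 (\<mu>$3 *\<^sub>R mat 1)"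
    by (simp add: LGR_Q_def)
  show ?thesis
    unfolding LGR_Q matrix_vector_mult_diff_rdistrib[of "\<epsilon>\<^sup>2 *\<^sub>R A_p - A_n"] inner_diff_right
      block3_mult_stack3 power2_norm_eq_inner
    by (simp add: inner_stack3 scaleR_matrix_vector_assoc[symmetric])
qed

text \<open>The sign of \<open>q(\<mu>)\<close> makes the bordered form at \<open>(x, t)\<close> the homogenised Lagrangian at \<open>- x / t\<close>.\<close>

lemma bordered_quadratic_form:
  "snoc6 (- t *\<^sub>R stack3 a b c) t \<bullet>
     (bordered (LGR_Q \<epsilon> \<mu>) (LGR_q Ca Cb Cc \<mu>) (LGR_r Ca Cb Cc ra rb rc \<mu> \<gamma>)
       *v snoc6 (- t *\<^sub>R stack3 a b c) t) =
   t\<^sup>2 * (\<gamma> + stack3 a b c \<bullet> ((\<epsilon>\<^sup>2 *\<^sub>R A_p - A_n) *v stack3 a b c)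
     - \<mu>$1 * ((norm (a - Ca))\<^sup>2 - ra\<^sup>2) - \<mu>$2 * ((norm (b - Cb))\<^sup>2 - rb\<^sup>2)
     - \<mu>$3 * ((norm (c - Cc))\<^sup>2 - rc\<^sup>2))"
proof -
  have dist: "(norm (u - v))\<^sup>2 = (norm u)\<^sup>2 - 2 * (v \<bullet> u) + (norm v)\<^sup>2" for u v :: "real^2"
    by (simp add: power2_norm_eq_inner inner_diff_left inner_diff_right inner_commute)
  have linear: "LGR_q Ca Cb Cc \<mu> \<bullet> stack3 a b c =
      - \<mu>$1 * (Ca \<bullet> a) - \<mu>$2 * (Cb \<bullet> b) - \<mu>$3 * (Cc \<bullet> c)"
    by (simp add: LGR_q_def inner_stack3)
  have homogeneous: "snoc6 (- t *\<^sub>R x) t \<bullet> (bordered Q q r *v snoc6 (- t *\<^sub>R x) t) =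
      t\<^sup>2 * (x \<bullet> (Q *v x) - 2 * (q \<bullet> x) + r)" for x q r and Q :: "real^6^6"
    by (simp add: bordered_mult_snoc6 inner_snoc6 inner_add_right matrix_vector_mult_scaleR
        linear_neg[OF matrix_vector_mul_linear] inner_commute power2_eq_square algebra_simps)
  show ?thesis
    unfolding homogeneous linear LGR_Q_quadratic_form LGR_r_def dist
    by (simp add: algebra_simps)
qed

lemma LGR_feasible_lagrangian_nonneg:
  assumes "(\<mu>, \<gamma>) \<in> LGR_feasible \<epsilon> Ca Cb Cc ra rb rc"
  shows "0 \<le> \<gamma> + stack3 a b c \<bullet> ((\<epsilon>\<^sup>2 *\<^sub>R A_p - A_n) *v stack3 a b c)
     - \<mu>$1 * ((norm (a - Ca))\<^sup>2 - ra\<^sup>2) - \<mu>$2 * ((norm (b - Cb))\<^sup>2 - rb\<^sup>2)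
     - \<mu>$3 * ((norm (c - Cc))\<^sup>2 - rc\<^sup>2)"
proof -
  have "0 \<le> x \<bullet> (bordered (LGR_Q \<epsilon> \<mu>) (LGR_q Ca Cb Cc \<mu>) (LGR_r Ca Cb Cc ra rb rc \<mu> \<gamma>) *v x)" for x
    using assms by (simp add: LGR_feasible_def psd_def)
  from this[of "snoc6 (- 1 *\<^sub>R stack3 a b c) 1"] show ?thesis
    unfolding bordered_quadratic_form by simp
qed

text \<open>A vector with nonzero last entry rescales to a value of the Lagrangian; one with last
  entry 0 sees only the block \<open>LGR_Q\<close>, which the first premise controls.\<close>

lemma LGR_feasibleI:
  assumes Q: "\<And>x. 0 \<le> x \<bullet> (LGR_Q \<epsilon> \<mu> *v x)"
    and L: "\<And>a b c. 0 \<le> \<gamma> + stack3 a b c \<bullet> ((\<epsilon>\<^sup>2 *\<^sub>R A_p - A_n) *v stack3 a b c)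
     - \<mu>$1 * ((norm (a - Ca))\<^sup>2 - ra\<^sup>2) - \<mu>$2 * ((norm (b - Cb))\<^sup>2 - rb\<^sup>2)
     - \<mu>$3 * ((norm (c - Cc))\<^sup>2 - rc\<^sup>2)"
  shows "(\<mu>, \<gamma>) \<in> LGR_feasible \<epsilon> Ca Cb Cc ra rb rc"
proof -
  let ?M = "bordered (LGR_Q \<epsilon> \<mu>) (LGR_q Ca Cb Cc \<mu>) (LGR_r Ca Cb Cc ra rb rc \<mu> \<gamma>)"
  have "0 \<le> z \<bullet> (?M *v z)" for z
  proof -
    obtain x t where z: "z = snoc6 x t"
      using ex_snoc6 by blast
    show ?thesis
    proof (cases "t = 0")
      case True
      then show ?thesis
        using Q by (simp add: z bordered_mult_snoc6 inner_snoc6)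
    next
      case False
      obtain a b c where abc: "- (1 / t) *\<^sub>R x = stack3 a b c"
        using ex_stack3 by blast
      have "x = - t *\<^sub>R stack3 a b c"
        using False by (simp flip: abc)
      then show ?thesis
        unfolding z by (simp only: bordered_quadratic_form) (intro mult_nonneg_nonneg L, simp)
    qed
  qed
  then show ?thesis
    by (simp add: LGR_feasible_def psd_def transpose_bordered transpose_LGR_Q)
qed

lemma primal_feasible_iff:
  "stack3 a b c \<in> primal_feasible Ca Cb Cc ra rb rc \<longleftrightarrow>
     norm (a - Ca) = ra \<and> norm (b - Cb) = rb \<and> norm (c - Cc) = rc"
proof -
  have "stack3 a b c = stack3 a' b' c' \<longleftrightarrow> a = a' \<and> b = b' \<and> c = c'" for a' b' c'
    using subvec2_stack3 by metis
  then show ?thesis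
    by (auto simp: primal_feasible_def product3_def frontier_cball dist_norm norm_minus_commute)
qed

lemma primal_objective:
  "V \<bullet> ((A_n - t *\<^sub>R A_p) *v V) = - (V \<bullet> ((t *\<^sub>R A_p - A_n) *v V))"
  by (simp add: matrix_vector_mult_diff_rdistrib inner_diff_right)

text \<open>On the circles all three constraint terms of the Lagrangian vanish, so its nonnegativity
  says that \<open>\<gamma>\<close> bounds the objective.\<close>

lemma weak_duality:
  "primal_value \<epsilon> Ca Cb Cc ra rb rc \<le> LGR_value \<epsilon> Ca Cb Cc ra rb rc"
  unfolding primal_value_def LGR_value_def
proof (intro SUP_least INF_greatest)
  fix V m
  assume V: "V \<in> primal_feasible Ca Cb Cc ra rb rc" and m: "m \<in> LGR_feasible \<epsilon> Ca Cb Cc ra rb rc"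
  obtain a b c where abc: "V = stack3 a b c" using ex_stack3 by blast
  obtain \<mu> \<gamma> where "m = (\<mu>, \<gamma>)" by force
  with m V show "ereal (V \<bullet> ((A_n - \<epsilon>\<^sup>2 *\<^sub>R A_p) *v V)) \<le> (case m of (\<mu>, \<gamma>) \<Rightarrow> ereal \<gamma>)"
    using LGR_feasible_lagrangian_nonneg[of \<mu> \<gamma> \<epsilon> Ca Cb Cc ra rb rc a b c]
    by (simp add: abc primal_feasible_iff primal_objective)
qed

section \<open>The relaxation to discs\<close>

lemma product3_iff:
  "x \<in> product3 S T U \<longleftrightarrow> subvec2 x 1 \<in> S \<and> subvec2 x 3 \<in> T \<and> subvec2 x 5 \<in> U"
proof -
  have "x \<in> product3 S T U" if "subvec2 x 1 \<in> S" "subvec2 x 3 \<in> T" "subvec2 x 5 \<in> U"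
    using that stack3_subvec2[of x] unfolding product3_def by force
  then show ?thesis
    by (auto simp: product3_def subvec2_stack3)
qed

text \<open>The product is the image of a compact set under the linear stacking map.\<close>

lemma compact_product3:
  assumes "compact S" "compact T" "compact U"
  shows "compact (product3 S T U)"
proof -
  have "linear (\<lambda>(a, b, c). stack3 a b c)"
    by (rule linearI) (auto simp: stack3_add stack3_scaleR)
  then have "continuous_on UNIV (\<lambda>(a, b, c). stack3 a b c)"
    by (intro linear_continuous_on) (simp add: linear_conv_bounded_linear)
  then have "compact ((\<lambda>(a, b, c). stack3 a b c) ` (S \<times> T \<times> U))"
    using assms by (intro compact_continuous_image compact_Times) (auto intro: continuous_on_subset)
  moreover have "(\<lambda>(a, b, c). stack3 a b c) ` (S \<times> T \<times> U) = product3 S T U"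
    by (force simp: product3_def)
  ultimately show ?thesis by simp
qed

text \<open>Cauchy-Schwarz block by block; with \<open>v\<close> a row of \<open>B\<close>, twice
  the bound is the half-width \<open>r $ i\<close> of the box.\<close>

lemma row_bound:
  assumes Y: "Y \<in> product3 (cball 0 ra) (cball 0 rb) (cball 0 rc)"
  shows "\<bar>v \<bullet> Y\<bar> \<le> ra * norm (subvec2 v 1) + rb * norm (subvec2 v 3) + rc * norm (subvec2 v 5)"
proof -
  have "\<bar>subvec2 v i \<bullet> subvec2 Y i\<bar> \<le> \<rho> * norm (subvec2 v i)"
    if "subvec2 Y i \<in> cball 0 \<rho>" for i \<rho>
  proof -
    have "\<bar>subvec2 v i \<bullet> subvec2 Y i\<bar> \<le> norm (subvec2 v i) * norm (subvec2 Y i)"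
      by (rule Cauchy_Schwarz_ineq2)
    also have "\<dots> \<le> norm (subvec2 v i) * \<rho>"
      using that by (intro mult_left_mono) auto
    finally show ?thesis by (simp add: mult.commute)
  qed
  from this[of 1 ra] this[of 3 rb] this[of 5 rc] Y show ?thesis
    unfolding inner_subvec2[of v Y] product3_iff by linarith
qed

text \<open>If both entries vanished, \<open>f\<close> would equal
  \<open>- 2 *\<^sub>R (B *v Y)\<close> there, and \<open>row_bound\<close> would place that pair
  inside the excluded box.\<close>

lemma subvec2_gradient_nonzero:
  assumes Y: "Y \<in> product3 (cball 0 ra) (cball 0 rb) (cball 0 rc)"
    and r: "r = (\<chi> i. 2 * (ra * norm (subvec2 (B $ i) 1)
                         + rb * norm (subvec2 (B $ i) 3)
                         + rc * norm (subvec2 (B $ i) 5)))"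
    and box: "(f $ i, f $ (i + 1)) \<notin> {- r $ i .. r $ i} \<times> {- r $ (i + 1) .. r $ (i + 1)}"
  shows "subvec2 (2 *\<^sub>R (B *v Y) + f) i \<noteq> 0"
proof
  assume "subvec2 (2 *\<^sub>R (B *v Y) + f) i = 0"
  then have "(2 *\<^sub>R (B *v Y) + f) $ i = 0" "(2 *\<^sub>R (B *v Y) + f) $ (i + 1) = 0"
    by (simp_all add: subvec2_def vec_eq_iff forall_2)
  then have "f $ i = - 2 * (B $ i \<bullet> Y)" "f $ (i + 1) = - 2 * (B $ (i + 1) \<bullet> Y)"
    by (simp_all add: matrix_vector_mul_component)
  then show False
    using box row_bound[OF Y, of "B $ i"] row_bound[OF Y, of "B $ (i + 1)"]
    by (auto simp: r abs_le_iff)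
qed

text \<open>The one-sided derivative along the segment from the minimiser to \<open>y\<close> cannot
  be negative.\<close>

lemma quadratic_min_variational:
  fixes B :: "real^'n^'n"
  assumes sym: "transpose B = B" and "convex D" and x: "x \<in> D" and y: "y \<in> D"
    and least: "\<And>z. z \<in> D \<Longrightarrow> x \<bullet> (B *v x) + f \<bullet> x \<le> z \<bullet> (B *v z) + f \<bullet> z"
  shows "0 \<le> (2 *\<^sub>R (B *v x) + f) \<bullet> (y - x)"
proof (rule linear_coefficient_nonneg)
  fix t :: real
  assume t: "0 < t" "t \<le> 1"
  have "(1 - t) *\<^sub>R x + t *\<^sub>R y \<in> D"
    using t x y \<open>convex D\<close> by (simp add: convexD_alt)
  then have "x + t *\<^sub>R (y - x) \<in> D"
    by (simp add: algebra_simps)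
  from least[OF this]
  show "0 \<le> t * ((2 *\<^sub>R (B *v x) + f) \<bullet> (y - x)) + t\<^sup>2 * ((y - x) \<bullet> (B *v (y - x)))"
    unfolding quadratic_form_add[OF sym] matrix_vector_mult_scaleR
    by (simp add: inner_add_left inner_add_right power2_eq_square distrib_left)
qed

theorem mainTheorem2:
  fixes \<epsilon> ra rb rc :: real
    and Ca Cb Cc :: "real^2"
    and B :: "real^6^6"
    and f r :: "real^6"
    and D :: "(real^6) set"
  assumes eps: "0 < \<epsilon>" "\<epsilon> < 1"
    and radii: "0 \<le> ra" "0 \<le> rb" "0 \<le> rc"
    and B: "B = (\<epsilon>\<^sup>2 *\<^sub>R A_p - A_n) - lambda_min (\<epsilon>\<^sup>2 *\<^sub>R A_p - A_n) *\<^sub>R mat 1"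
    and f: "f = 2 *\<^sub>R ((\<epsilon>\<^sup>2 *\<^sub>R A_p - A_n) *v stack3 Ca Cb Cc)"
    and r: "r = (\<chi> i. 2 * (ra * norm (subvec2 (B $ i) 1)
                         + rb * norm (subvec2 (B $ i) 3)
                         + rc * norm (subvec2 (B $ i) 5)))"
    and D: "D = product3 (cball 0 ra) (cball 0 rb) (cball 0 rc)"
    and box: "\<forall>i \<in> {1, 3, 5}. (f $ i, f $ (i + 1)) \<notin> {- r $ i .. r $ i} \<times> {- r $ (i + 1) .. r $ (i + 1)}"
    and min_a: "(INF Y \<in> D. (norm (subvec2 (2 *\<^sub>R (B *v Y) + f) 1))\<^sup>2) \<ge> 4 * (2 + \<epsilon>\<^sup>2)\<^sup>2 * ra\<^sup>2"
    and min_b: "(INF Y \<in> D. (norm (subvec2 (2 *\<^sub>R (B *v Y) + f) 3))\<^sup>2) \<ge> 4 * (2 + \<epsilon>\<^sup>2)\<^sup>2 * rb\<^sup>2"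
    and min_c: "(INF Y \<in> D. (norm (subvec2 (2 *\<^sub>R (B *v Y) + f) 5))\<^sup>2) \<ge> 4 * (2 + \<epsilon>\<^sup>2)\<^sup>2 * rc\<^sup>2"
  shows "primal_value \<epsilon> Ca Cb Cc ra rb rc = LGR_value \<epsilon> Ca Cb Cc ra rb rc"
proof (rule antisym[OF weak_duality])

  \<comment> \<open>Reduction to a convex quadratic in the displacement from the centres\<close>
  define M where "M = \<epsilon>\<^sup>2 *\<^sub>R A_p - A_n"
  define l where "l = lambda_min M"
  define C where "C = stack3 Ca Cb Cc"
  have symM: "transpose M = M"
    unfolding M_def by (metis minus_diff_eq transpose_uminus transpose_objective)
  have B': "B *v x = M *v x - l *\<^sub>R x" for x
    by (simp add: B M_def l_def matrix_vector_mult_diff_rdistrib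
        scaleR_matrix_vector_assoc[symmetric])
  have symB: "transpose B = B"
    using symM by (simp add: B M_def transpose_diff transpose_scalar)
  \<comment> \<open>Shifting by the smallest eigenvalue makes the form positive semidefinite, so
    \<open>g\<close> below is convex.\<close>
  have B_nonneg: "0 \<le> x \<bullet> (B *v x)" for x
    using lambda_min_le_quadratic_form[OF symM, of x]
    by (simp add: B' l_def inner_diff_right power2_norm_eq_inner)
  have f': "f = 2 *\<^sub>R (M *v C)"
    by (simp add: f M_def C_def)

  define g where "g x = x \<bullet> (B *v x) + f \<bullet> x" for x
  \<comment> \<open>The shift by \<open>l\<close> splits off \<open>l * (norm w)\<^sup>2\<close>,
    which is constant on the product of circles.\<close>
  have shift: "(C + w) \<bullet> (M *v (C + w)) = C \<bullet> (M *v C) + g w + l * (norm w)\<^sup>2" for w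
    by (simp add: quadratic_form_add[OF symM] g_def B' f' inner_diff_right power2_norm_eq_inner)

  \<comment> \<open>The minimiser over the product of discs\<close>
  have "continuous_on D g"
    unfolding g_def
    by (intro continuous_intros linear_continuous_on matrix_vector_mul_bounded_linear)
  moreover have "compact D"
    unfolding D by (intro compact_product3 compact_cball)
  moreover have "stack3 0 0 0 \<in> D"
    using radii by (simp add: D product3_iff subvec2_stack3)
  ultimately obtain X where X: "X \<in> D" and least: "\<And>y. y \<in> D \<Longrightarrow> g X \<le> g y"
    using continuous_attains_inf[of D g] by blast
  define G where "G = 2 *\<^sub>R (B *v X) + f"
  have convex: "convex D"
    unfolding D
  proof (rule convexI)
    fix x y :: "real^6" and u v :: real
    assume *: "x \<in> product3 (cball 0 ra) (cball 0 rb) (cball 0 rc)"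
      "y \<in> product3 (cball 0 ra) (cball 0 rb) (cball 0 rc)" "0 \<le> u" "0 \<le> v" "u + v = 1"
    have "subvec2 (u *\<^sub>R x + v *\<^sub>R y) i = u *\<^sub>R subvec2 x i + v *\<^sub>R subvec2 y i" for i
      by (simp add: subvec2_def vec_eq_iff forall_2)
    with * show "u *\<^sub>R x + v *\<^sub>R y \<in> product3 (cball 0 ra) (cball 0 rb) (cball 0 rc)"
      unfolding product3_iff by (simp only: convexD[OF convex_cball])
  qed
  have var: "0 \<le> G \<bullet> (y - X)" if "y \<in> D" for y
    unfolding G_def using quadratic_min_variational[OF symB convex X that, of f] least
    by (simp add: g_def)
  obtain xa xb xc where Xabc: "X = stack3 xa xb xc" using ex_stack3 by blast
  obtain ga gb gc where Gabc: "G = stack3 ga gb gc" using ex_stack3 by blast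
  have D_iff: "stack3 a b c \<in> D \<longleftrightarrow> a \<in> cball 0 ra \<and> b \<in> cball 0 rb \<and> c \<in> cball 0 rc" for a b c
    unfolding D product3_iff subvec2_stack3 by (rule refl)
  have mem: "xa \<in> cball 0 ra" "xb \<in> cball 0 rb" "xc \<in> cball 0 rc"
    using X by (simp_all only: Xabc D_iff)
  have "subvec2 G i \<noteq> 0" if "i \<in> {1, 3, 5}" for i
    unfolding G_def using X box that by (intro subvec2_gradient_nonzero[OF _ r]) (auto simp: D)
  from this[of 1] this[of 3] this[of 5] have nz: "ga \<noteq> 0" "gb \<noteq> 0" "gc \<noteq> 0"
    by (simp_all add: Gabc subvec2_stack3)
  \<comment> \<open>Moving one block while the other two stay at \<open>X\<close> reduces the
    variational inequality to a linear problem on a single disc.\<close>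
  have xa: "xa = - (ra / norm ga) *\<^sub>R ga"
  proof (rule linear_min_on_cball)
    show "0 \<le> ga \<bullet> (y - xa)" if "y \<in> cball 0 ra" for y
      using var[of "stack3 y xb xc"] mem that
      by (simp add: Xabc Gabc D_iff stack3_diff inner_stack3)
  qed (use mem nz in auto)
  have xb: "xb = - (rb / norm gb) *\<^sub>R gb"
  proof (rule linear_min_on_cball)
    show "0 \<le> gb \<bullet> (y - xb)" if "y \<in> cball 0 rb" for y
      using var[of "stack3 xa y xc"] mem that
      by (simp add: Xabc Gabc D_iff stack3_diff inner_stack3)
  qed (use mem nz in auto)
  have xc: "xc = - (rc / norm gc) *\<^sub>R gc"
  proof (rule linear_min_on_cball)
    show "0 \<le> gc \<bullet> (y - xc)" if "y \<in> cball 0 rc" for y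
      using var[of "stack3 xa xb y"] mem that
      by (simp add: Xabc Gabc D_iff stack3_diff inner_stack3)
  qed (use mem nz in auto)
  have norms: "norm xa = ra" "norm xb = rb" "norm xc = rc"
    using radii nz by (simp_all add: xa xb xc)

  \<comment> \<open>The primal value attained at the disc minimiser\<close>
  define p where "p = (C + X) \<bullet> (M *v (C + X))"
  have "C + X \<in> primal_feasible Ca Cb Cc ra rb rc"
    by (simp add: C_def Xabc stack3_add primal_feasible_iff norms)
  then have "ereal ((C + X) \<bullet> ((A_n - \<epsilon>\<^sup>2 *\<^sub>R A_p) *v (C + X))) \<le> primal_value \<epsilon> Ca Cb Cc ra rb rc"
    unfolding primal_value_def by (rule SUP_upper)
  then have primal: "ereal (- p) \<le> primal_value \<epsilon> Ca Cb Cc ra rb rc"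
    by (simp only: primal_objective p_def M_def)
  have p: "p = C \<bullet> (M *v C) + g X + l * (ra\<^sup>2 + rb\<^sup>2 + rc\<^sup>2)"
    unfolding p_def shift by (simp add: Xabc norm_stack3 norms)

  \<comment> \<open>Multipliers that are optimal up to an arbitrary error\<close>
  have "LGR_value \<epsilon> Ca Cb Cc ra rb rc \<le> ereal (- p) + ereal e" if "0 < e" for e
  proof -
    \<comment> \<open>Each of the three blocks may lose one \<open>\<delta>\<close>.\<close>
    define \<delta> where "\<delta> = e / 3"
    have \<delta>: "0 < \<delta>" using that by (simp add: \<delta>_def)
    obtain na where na: "0 \<le> na"
      "\<And>h. - \<delta> \<le> ga \<bullet> h + na * ((norm (xa + h))\<^sup>2 - ra\<^sup>2)"
      using disc_multiplier[OF xa nz(1) radii(1) \<delta>] by blast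
    obtain nb where nb: "0 \<le> nb"
      "\<And>h. - \<delta> \<le> gb \<bullet> h + nb * ((norm (xb + h))\<^sup>2 - rb\<^sup>2)"
      using disc_multiplier[OF xb nz(2) radii(2) \<delta>] by blast
    obtain nc where nc: "0 \<le> nc"
      "\<And>h. - \<delta> \<le> gc \<bullet> h + nc * ((norm (xc + h))\<^sup>2 - rc\<^sup>2)"
      using disc_multiplier[OF xc nz(3) radii(3) \<delta>] by blast
    \<comment> \<open>With this choice \<open>LGR_Q\<close> becomes \<open>B\<close> plus the block
      diagonal of \<open>na\<close>, \<open>nb\<close>, \<open>nc\<close>, a sum of positive
      semidefinite matrices.\<close>
    define \<mu> :: "real^3" where "\<mu> = vector [l - na, l - nb, l - nc]"
    have \<mu>: "\<mu>$1 = l - na" "\<mu>$2 = l - nb" "\<mu>$3 = l - nc"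
      by (simp_all add: \<mu>_def)
    have "(\<mu>, - p + e) \<in> LGR_feasible \<epsilon> Ca Cb Cc ra rb rc"
    proof (rule LGR_feasibleI)
      fix x :: "real^6"
      obtain a b c where x: "x = stack3 a b c" using ex_stack3 by blast
      have "x \<bullet> (LGR_Q \<epsilon> \<mu> *v x) =
          x \<bullet> (B *v x) + (na * (norm a)\<^sup>2 + nb * (norm b)\<^sup>2 + nc * (norm c)\<^sup>2)"
        unfolding B' inner_diff_right inner_scaleR_right power2_norm_eq_inner[symmetric]
        unfolding x LGR_Q_quadratic_form M_def[symmetric] \<mu> norm_stack3
        by (simp add: algebra_simps)
      then show "0 \<le> x \<bullet> (LGR_Q \<epsilon> \<mu> *v x)"
        using B_nonneg[of x] na nb nc by simp
    next
      fix a b c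
      define ha hb hc where "ha = a - Ca - xa" and "hb = b - Cb - xb" and "hc = c - Cc - xc"
      define H where "H = stack3 ha hb hc"
      have h: "a - Ca = xa + ha" "b - Cb = xb + hb" "c - Cc = xc + hc"
        by (simp_all add: ha_def hb_def hc_def)
      have V: "stack3 a b c = C + (X + H)"
        by (simp add: C_def Xabc H_def stack3_add ha_def hb_def hc_def)
      \<comment> \<open>Convexity of \<open>g\<close> at \<open>X\<close>: the second-order
        remainder is \<open>H \<bullet> (B *v H)\<close>.\<close>
      have gap: "g X + G \<bullet> H \<le> g (X + H)"
        using B_nonneg[of H] unfolding g_def G_def quadratic_form_add[OF symB]
        by (simp add: inner_add_left inner_add_right)
      have GH: "G \<bullet> H = ga \<bullet> ha + gb \<bullet> hb + gc \<bullet> hc"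
        by (simp add: Gabc H_def inner_stack3)
      have XH: "(norm (X + H))\<^sup>2 =
          (norm (xa + ha))\<^sup>2 + (norm (xb + hb))\<^sup>2 + (norm (xc + hc))\<^sup>2"
        by (simp add: Xabc H_def stack3_add norm_stack3)
      have e: "e = 3 * \<delta>"
        by (simp add: \<delta>_def)
      \<comment> \<open>All terms in \<open>l\<close> cancel: those from \<open>shift\<close> and
        \<open>p\<close> against those from \<open>\<mu>\<close>. What remains is the convexity gap
        and one nonnegative multiplier term per disc.\<close>
      have "- p + e + stack3 a b c \<bullet> ((\<epsilon>\<^sup>2 *\<^sub>R A_p - A_n) *v stack3 a b c)
          - \<mu>$1 * ((norm (a - Ca))\<^sup>2 - ra\<^sup>2) - \<mu>$2 * ((norm (b - Cb))\<^sup>2 - rb\<^sup>2)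
          - \<mu>$3 * ((norm (c - Cc))\<^sup>2 - rc\<^sup>2) =
          (g (X + H) - (g X + G \<bullet> H))
          + (\<delta> + (ga \<bullet> ha + na * ((norm (xa + ha))\<^sup>2 - ra\<^sup>2)))
          + (\<delta> + (gb \<bullet> hb + nb * ((norm (xb + hb))\<^sup>2 - rb\<^sup>2)))
          + (\<delta> + (gc \<bullet> hc + nc * ((norm (xc + hc))\<^sup>2 - rc\<^sup>2)))"
        unfolding M_def[symmetric] V shift p \<mu> h XH GH e
        by (simp add: algebra_simps)
      with gap show "0 \<le> - p + e + stack3 a b c \<bullet> ((\<epsilon>\<^sup>2 *\<^sub>R A_p - A_n) *v stack3 a b c)
          - \<mu>$1 * ((norm (a - Ca))\<^sup>2 - ra\<^sup>2) - \<mu>$2 * ((norm (b - Cb))\<^sup>2 - rb\<^sup>2)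
          - \<mu>$3 * ((norm (c - Cc))\<^sup>2 - rc\<^sup>2)"
        using na(2)[of ha] nb(2)[of hb] nc(2)[of hc] by linarith
    qed
    then have "LGR_value \<epsilon> Ca Cb Cc ra rb rc \<le> (case (\<mu>, - p + e) of (\<mu>, \<gamma>) \<Rightarrow> ereal \<gamma>)"
      unfolding LGR_value_def by (rule INF_lower)
    then show ?thesis by simp
  qed
  \<comment> \<open>Letting \<open>e\<close> tend to 0 suffices because the dual value is an
    infimum, attained or not.\<close>
  then have "LGR_value \<epsilon> Ca Cb Cc ra rb rc \<le> ereal (- p)"
    by (rule ereal_le_epsilon2)
  with primal show "LGR_value \<epsilon> Ca Cb Cc ra rb rc \<le> primal_value \<epsilon> Ca Cb Cc ra rb rc"
    by (rule order_trans[rotated])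
qed

end
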